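(* Let $(X,\tau,T_1,T_2)$ be a $\mathcal{B}$-connected bi-operator topological space and $(Y,\sigma)$ a topological space. If $f:(X,\tau,T_1,T_2)\to(Y,\sigma)$ is contra-$\mathcal{B}$-continuous and onto $Y$, then $Y$ is not a discrete space.
   Context: An operator associated with a topology $\tau$ on $X$ is a function $T:P(X)\to P(X)$ ($P(X)$ the power set of $X$) such that $U\subseteq T(U)$ for all $U\in\tau$. A bi-operator topological space $(X,\tau,T_1,T_2)$ is a topological space $(X,\tau)$ with two operators $T_1,T_2$ associated with $\tau$. A subset $S\subseteq X$ is $\mathcal{B}$-open if $S\subseteq T_1(S)\cup T_2(S)$, and $\mathcal{B}$-closed if its complement is $\mathcal{B}$-open. A function $f:(X,\tau,T_1,T_2)\to(Y,\sigma)$ is contra-$\mathcal{B}$-continuous if $f^{-1}(V)$ is $\mathcal{B}$-closed in $X$ for each open subset $V$ of $Y$. $(X,\tau,T_1,T_2)$ is $\mathcal{B}$-connected if $X$ is not the union of two disjoint nonempty $\mathcal{B}$-open sets.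
   Formalization: The formal statement additionally assumes that Y has at least two points; without this the claim is false, since every space with at most one point is discrete (e.g. X = Y a single point with identity operators). *)

theory Defs
  imports "HOL-Analysis.Abstract_Topology"
begin

definition operator_associated :: "'a topology \<Rightarrow> ('a set \<Rightarrow> 'a set) \<Rightarrow> bool" where
  "operator_associated X T \<longleftrightarrow>
     T \<in> Pow (topspace X) \<rightarrow> Pow (topspace X) \<and> (\<forall>U. openin X U \<longrightarrow> U \<subseteq> T U)"

definition bi_operator_space ::
    "'a topology \<Rightarrow> ('a set \<Rightarrow> 'a set) \<Rightarrow> ('a set \<Rightarrow> 'a set) \<Rightarrow> bool" where
  "bi_operator_space X T1 T2 \<longleftrightarrow> operator_associated X T1 \<and> operator_associated X T2"

definition B_open ::
    "'a topology \<Rightarrow> ('a set \<Rightarrow> 'a set) \<Rightarrow> ('a set \<Rightarrow> 'a set) \<Rightarrow> 'a set \<Rightarrow> bool" where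
  "B_open X T1 T2 S \<longleftrightarrow> S \<subseteq> topspace X \<and> S \<subseteq> T1 S \<union> T2 S"

definition B_closed ::
    "'a topology \<Rightarrow> ('a set \<Rightarrow> 'a set) \<Rightarrow> ('a set \<Rightarrow> 'a set) \<Rightarrow> 'a set \<Rightarrow> bool" where
  "B_closed X T1 T2 S \<longleftrightarrow> S \<subseteq> topspace X \<and> B_open X T1 T2 (topspace X - S)"

definition contra_B_continuous ::
    "'a topology \<Rightarrow> ('a set \<Rightarrow> 'a set) \<Rightarrow> ('a set \<Rightarrow> 'a set) \<Rightarrow> 'b topology \<Rightarrow> ('a \<Rightarrow> 'b) \<Rightarrow> bool" where
  "contra_B_continuous X T1 T2 Y f \<longleftrightarrow>
     f \<in> topspace X \<rightarrow> topspace Y \<and>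
     (\<forall>V. openin Y V \<longrightarrow> B_closed X T1 T2 {x \<in> topspace X. f x \<in> V})"

definition B_connected ::
    "'a topology \<Rightarrow> ('a set \<Rightarrow> 'a set) \<Rightarrow> ('a set \<Rightarrow> 'a set) \<Rightarrow> bool" where
  "B_connected X T1 T2 \<longleftrightarrow>
     \<not> (\<exists>U V. B_open X T1 T2 U \<and> B_open X T1 T2 V \<and> U \<noteq> {} \<and> V \<noteq> {} \<and>
              U \<inter> V = {} \<and> U \<union> V = topspace X)"

end

theory Submission
  imports Defs
begin

text \<open>
  Contra-\<open>\<B>\<close>-continuity turns a partition of \<open>Y\<close> into two open pieces into a partition of \<open>X\<close>
  into two \<open>\<B>\<close>-closed pieces. Each piece is the complement of the other, so both are also
  \<open>\<B>\<close>-open, and \<open>\<B>\<close>-connectedness forces one of them to be empty. When the function is onto, this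
  means that \<open>Y\<close> itself is connected (\<open>contra_B_continuous_image_connected_space\<close>); a
  discrete space with two distinct points is not.
\<close>

text \<open>
  The complement of a \<open>\<B>\<close>-closed set is \<open>\<B>\<close>-open by definition; a two-piece partition
  exchanges the roles of piece and complement.
\<close>

lemma B_connected_no_B_closed_partition:
  assumes "B_connected X T1 T2" "B_closed X T1 T2 A" "B_closed X T1 T2 B"
    and "A \<inter> B = {}" "A \<union> B = topspace X"
  shows "A = {} \<or> B = {}"
proof -
  have "topspace X - A = B" "topspace X - B = A"
    using assms(4,5) by auto
  then have "B_open X T1 T2 A" "B_open X T1 T2 B"
    using assms(2,3) by (auto simp: B_closed_def)
  then show ?thesis
    using assms(1,4,5) unfolding B_connected_def by blast
qed

text \<open>
  The proof pulls a separation of \<open>Y\<close> back to \<open>X\<close>; surjectivity keeps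
  both preimages nonempty.
\<close>

lemma contra_B_continuous_image_connected_space:
  assumes "B_connected X T1 T2" "contra_B_continuous X T1 T2 Y f"
    and "f ` topspace X = topspace Y"
  shows "connected_space Y"
  unfolding connected_space_eq
proof (intro notI, elim exE conjE)
  fix V W
  assume V: "openin Y V" "V \<noteq> {}" and W: "openin Y W" "W \<noteq> {}"
    and cover: "V \<union> W = topspace Y" and disjoint: "V \<inter> W = {}"
  let ?A = "{x \<in> topspace X. f x \<in> V}" and ?B = "{x \<in> topspace X. f x \<in> W}"
  have "B_closed X T1 T2 ?A" "B_closed X T1 T2 ?B"
    using assms(2) V(1) W(1) by (auto simp: contra_B_continuous_def)
  moreover have "?A \<inter> ?B = {}"
    using disjoint by auto
  moreover have "?A \<union> ?B = topspace X"
    using assms(3) cover by auto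
  ultimately have "?A = {} \<or> ?B = {}"
    by (rule B_connected_no_B_closed_partition[OF assms(1)])
  moreover have "V \<subseteq> f ` topspace X" "W \<subseteq> f ` topspace X"
    using assms(3) cover by auto
  ultimately show False
    using V(2) W(2) by blast
qed

theorem proposition24:
  fixes X :: "'a topology" and Y :: "'b topology"
    and T1 T2 :: "'a set \<Rightarrow> 'a set" and f :: "'a \<Rightarrow> 'b"
  assumes "bi_operator_space X T1 T2"
    and "B_connected X T1 T2"
    and "contra_B_continuous X T1 T2 Y f"
    and "f ` topspace X = topspace Y"
    and at_least_two_points: "\<exists>y\<in>topspace Y. \<exists>z\<in>topspace Y. y \<noteq> z"
  shows "Y \<noteq> discrete_topology (topspace Y)"
proof
  assume discrete: "Y = discrete_topology (topspace Y)"
  obtain y z where yz: "y \<in> topspace Y" "z \<in> topspace Y" "y \<noteq> z"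
    using at_least_two_points by blast
  have open_iff: "openin Y S \<longleftrightarrow> S \<subseteq> topspace Y" for S
    by (subst discrete) simp
  have "openin Y {y}" "openin Y (topspace Y - {y})"
    using yz(1) by (auto simp: open_iff)
  moreover have "{y} \<union> (topspace Y - {y}) = topspace Y" "topspace Y - {y} \<noteq> {}"
    using yz by auto
  moreover have "connected_space Y"
    using assms(2-4) by (rule contra_B_continuous_image_connected_space)
  ultimately show False
    unfolding connected_space_eq by blast
qed

end
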